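(* Let $K=\mathbb{R}$ with the trivial absolute value and let $V$ be a real vector space of dimension $n$. There is a bijection $$\mathfrak{R}\mathcal{X}(V)\ \stackrel{1:1}{\longleftrightarrow}\ \big\{\big(0\subseteq V_0\subsetneq V_1\subsetneq\dots\subsetneq V_l=V^*,\ 0<d_1\le\dots\le d_{l-1}\le1\big)\big\},$$ where the right-hand side runs over all equivalence classes of signed flags $0\subseteq V_0\subsetneq V_1\subsetneq\dots\subsetneq V_l=V^*$ of subspaces of $V^*$, together with real numbers $0<d_1\le\dots\le d_{l-1}\le1$.
   Context: The trivial absolute value on $\mathbb{R}$ is $|0|=0$, $|\lambda|=1$ for $\lambda\neq0$. A signed seminorm on a finite-dimensional real vector space $W$ is a map $\|\cdot\|^{\mathrm{sgn}}\colon W\to\mathbb{R}$ with (i) $\|\lambda v\|^{\mathrm{sgn}}=\mathrm{sgn}(\lambda)|\lambda|\,\|v\|^{\mathrm{sgn}}$ for $\lambda\in\mathbb{R}$, $v\in W$; (ii) $\min(\|v\|^{\mathrm{sgn}},\|w\|^{\mathrm{sgn}})\le\|v+w\|^{\mathrm{sgn}}\le\max(\|v\|^{\mathrm{sgn}},\|w\|^{\mathrm{sgn}})$ for $v,w\in W$. $\mathfrak{R}\mathcal{X}(V)$ is the set of not identically zero signed seminorms on the dual space $V^*$ modulo homothety (multiplication by a constant in $\mathbb{R}\setminus\{0\}$). A signed flag of subspaces of a finite-dimensional real vector space $W$ consists of: a flag $0\subseteq V_0\subsetneq V_1\subsetneq\dots\subsetneq V_l=W$ of subspaces with $l\ge1$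 such that $\dim V_{i-1}=\dim V_i-1$ for all $i=1,\dots,l$ ($V_0$ may be any proper subspace of $W$, so $l=\dim W-\dim V_0$ varies); and, for every $i=1,\dots,l$, a choice of one of the two convex regions (open half-spaces) of $V_i\setminus V_{i-1}$. Two signed flags are equivalent if their underlying flags of subspaces coincide and their choices of regions are either the same for all $i$ or exactly opposite for all $i$. *)

theory Defs
  imports Complex_Main
begin

typedef (overloaded) 'v dual = "{f :: 'v::real_vector \<Rightarrow> real. linear f}"
  morphisms dual_apply Dual
  using linear_zero by blast

lemma linear_dual_apply: "linear (dual_apply f)"
  using dual_apply by blast

lemma dual_eqI: "(\<And>x. dual_apply f x = dual_apply g x) \<Longrightarrow> f = g"
  by (metis dual_apply_inject ext)

instantiation dual :: (real_vector) real_vector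
begin

definition "0 = Dual (\<lambda>x. 0)"
definition "f + g = Dual (\<lambda>x. dual_apply f x + dual_apply g x)"
definition "f - g = Dual (\<lambda>x. dual_apply f x - dual_apply g x)"
definition "- f = Dual (\<lambda>x. - dual_apply f x)"
definition "a *\<^sub>R f = Dual (\<lambda>x. a * dual_apply f x)"

lemma dual_apply_simps [simp]:
  "dual_apply 0 x = 0"
  "dual_apply (f + g) x = dual_apply f x + dual_apply g x"
  "dual_apply (f - g) x = dual_apply f x - dual_apply g x"
  "dual_apply (- f) x = - dual_apply f x"
  "dual_apply (a *\<^sub>R f) x = a * dual_apply f x"
proof -
  have lin: "linear (\<lambda>x :: 'a. 0 :: real)"
    "linear (\<lambda>x. dual_apply f x + dual_apply g x)"
    "linear (\<lambda>x. dual_apply f x - dual_apply g x)"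
    "linear (\<lambda>x. - dual_apply f x)"
    "linear (\<lambda>x. a * dual_apply f x)"
    using linear_dual_apply[of f] linear_dual_apply[of g]
    by (auto simp: linear_iff algebra_simps)
  then show
    "dual_apply 0 x = 0"
    "dual_apply (f + g) x = dual_apply f x + dual_apply g x"
    "dual_apply (f - g) x = dual_apply f x - dual_apply g x"
    "dual_apply (- f) x = - dual_apply f x"
    "dual_apply (a *\<^sub>R f) x = a * dual_apply f x"
    by (simp_all add: zero_dual_def plus_dual_def minus_dual_def uminus_dual_def
        scaleR_dual_def Dual_inverse)
qed

instance
  by standard (auto intro!: dual_eqI simp: algebra_simps)

end

definition trivial_abs :: "real \<Rightarrow> real" where
  "trivial_abs a = (if a = 0 then 0 else 1)"

definition signed_seminorm :: "('w::real_vector \<Rightarrow> real) \<Rightarrow> bool" where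
  "signed_seminorm N \<longleftrightarrow>
     (\<forall>a v. N (a *\<^sub>R v) = sgn a * trivial_abs a * N v) \<and>
     (\<forall>v w. min (N v) (N w) \<le> N (v + w) \<and> N (v + w) \<le> max (N v) (N w))"

definition nonzero_signed_seminorms :: "('w::real_vector \<Rightarrow> real) set" where
  "nonzero_signed_seminorms = {N. signed_seminorm N \<and> (\<exists>v. N v \<noteq> 0)}"

definition homothety :: "(('w::real_vector \<Rightarrow> real) \<times> ('w \<Rightarrow> real)) set" where
  "homothety = {(N, M). N \<in> nonzero_signed_seminorms \<and> M \<in> nonzero_signed_seminorms \<and>
     (\<exists>c. c \<noteq> 0 \<and> (\<forall>v. M v = c * N v))}"

definition RX :: "('v::real_vector dual \<Rightarrow> real) set set" where
  "RX = nonzero_signed_seminorms // homothety"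

definition open_half_space :: "'w::real_vector set \<Rightarrow> 'w set \<Rightarrow> 'w set \<Rightarrow> bool" where
  "open_half_space U U' H \<longleftrightarrow>
     (\<exists>f :: 'w \<Rightarrow> real. linear f \<and> U = {v \<in> U'. f v = 0} \<and> H = {v \<in> U'. f v > 0})"

text \<open>A signed flag \<open>V\<^sub>0 \<subset> \<dots> \<subset> V\<^sub>l\<close> of the whole space is encoded as the pair of the list
  \<open>[V\<^sub>0, \<dots>, V\<^sub>l]\<close> and the list \<open>[H\<^sub>1, \<dots>, H\<^sub>l]\<close> of chosen regions. List positions start at 0, so
  position \<open>i\<close> of the second list is the region of \<open>V\<^sub>i\<^sub>+\<^sub>1 - V\<^sub>i\<close>.\<close>

type_synonym 'w sflag = "'w set list \<times> 'w set list"

definition signed_flags :: "'w::real_vector sflag set" where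
  "signed_flags = {(Vs, Hs).
     length Hs \<ge> 1 \<and> length Vs = length Hs + 1 \<and>
     (\<forall>U \<in> set Vs. subspace U) \<and> last Vs = UNIV \<and>
     (\<forall>i < length Hs. Vs ! i \<subset> Vs ! (i + 1) \<and> dim (Vs ! i) = dim (Vs ! (i + 1)) - 1 \<and>
        open_half_space (Vs ! i) (Vs ! (i + 1)) (Hs ! i))}"

definition flag_equiv :: "('w::real_vector sflag \<times> 'w sflag) set" where
  "flag_equiv = {(F, G). F \<in> signed_flags \<and> G \<in> signed_flags \<and> fst F = fst G \<and>
     (snd G = snd F \<or> snd G = map (\<lambda>H. uminus ` H) (snd F))}"

text \<open>The weights \<open>[d\<^sub>1, \<dots>, d\<^sub>l\<^sub>-\<^sub>1]\<close> of a flag of length \<open>l\<close>.\<close>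

definition flag_weights :: "nat \<Rightarrow> real list set" where
  "flag_weights l = {ds. length ds = l - 1 \<and> sorted ds \<and> (\<forall>d \<in> set ds. 0 < d \<and> d \<le> 1)}"

definition weighted_signed_flags :: "('w::real_vector sflag \<times> real list) set" where
  "weighted_signed_flags = {(F, ds). F \<in> signed_flags \<and> ds \<in> flag_weights (length (snd F))}"

definition weighted_flag_classes :: "('w::real_vector sflag set \<times> real list) set" where
  "weighted_flag_classes = {(flag_equiv `` {F}, ds) | F ds. (F, ds) \<in> weighted_signed_flags}"

text \<open>The correspondence behind the bijection: up to a common factor, the seminorm vanishes exactly
  on \<open>V\<^sub>0\<close> and takes the value \<open>d\<^sub>i\<close> on the chosen region of \<open>V\<^sub>i - V\<^sub>i\<^sub>-\<^sub>1\<close> (hence \<open>- d\<^sub>i\<close> on the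
  opposite one), where \<open>d\<^sub>l = 1\<close>.\<close>

definition encoded_by :: "('w::real_vector \<Rightarrow> real) \<Rightarrow> 'w sflag \<Rightarrow> real list \<Rightarrow> bool" where
  "encoded_by N F ds \<longleftrightarrow>
     (\<forall>v \<in> fst F ! 0. N v = 0) \<and>
     (\<exists>c. c \<noteq> 0 \<and> (\<forall>i < length (snd F). \<forall>v \<in> snd F ! i. N v = c * (ds @ [1]) ! i))"

lemma equiv_homothety: "equiv nonzero_signed_seminorms homothety"
proof (rule equivI)
  show "homothety \<subseteq> nonzero_signed_seminorms \<times> (nonzero_signed_seminorms :: ('w::real_vector \<Rightarrow> real) set)"
    by (auto simp: homothety_def)
  show "refl_on nonzero_signed_seminorms (homothety :: (('w::real_vector \<Rightarrow> real) \<times> _) set)"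
    by (auto simp: homothety_def refl_on_def intro!: exI[of _ 1])
  show "sym (homothety :: (('w::real_vector \<Rightarrow> real) \<times> _) set)"
  proof (rule symI)
    fix N M :: "'w \<Rightarrow> real" assume "(N, M) \<in> homothety"
    then obtain c where "c \<noteq> 0" "\<forall>v. M v = c * N v"
      and "N \<in> nonzero_signed_seminorms" "M \<in> nonzero_signed_seminorms"
      by (auto simp: homothety_def)
    then show "(M, N) \<in> homothety"
      by (auto simp: homothety_def intro!: exI[of _ "inverse c"])
  qed
  show "trans (homothety :: (('w::real_vector \<Rightarrow> real) \<times> _) set)"
    unfolding trans_def homothety_def
    by clarsimp (metis mult.assoc mult_eq_0_iff)
qed

lemma equiv_flag_equiv: "equiv signed_flags flag_equiv"
  by (rule equivI)
    (auto simp: flag_equiv_def refl_on_def sym_def trans_def image_image o_def)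

end

theory Submission imports Defs begin

text \<open>A signed seminorm \<open>N\<close> on a finite-dimensional space \<open>W\<close> is constant on open rays, so it resembles
  a valuation refined by a sign. The set \<open>N v \<ge> 0\<close> is a convex cone which together with its opposite
  covers \<open>W\<close>, and \<open>N v = 0\<close> defines a subspace. If \<open>N\<close> is not zero, such a cone has a supporting
  functional \<open>f \<noteq> 0\<close>, that is, \<open>f v > 0\<close> forces \<open>N v > 0\<close>. The ultrametric inequality then shows that
  \<open>N\<close> is constant on the half-space \<open>f > 0\<close> and that this constant is the maximum of \<open>N\<close>
  (lemma \<open>signed_seminorm_maximal_half_space\<close>). The same argument applies to the hyperplane \<open>f = 0\<close>,
  and so on until \<open>N\<close> vanishes; this yields the signed flag, and the successive maxima are its weights
  up to the common factor that makes the largest one \<open>1\<close>. The functional has to be obtained from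
  the sign of \<open>N\<close> alone: two steps of the flag may carry the same weight, as for a lexicographic
  order of the plane, and then the subspaces \<open>\<bar>N v\<bar> \<le> a\<close> do not include all members of the flag.

  Conversely, the flag can be read off from \<open>N\<close>. An odd function cannot be constant and nonzero on
  open half-spaces with two different boundary hyperplanes, because a line that is parallel to one of the
  hyperplanes but not to the other can be placed inside the first half-space, and it meets both sides of the
  other hyperplane
  (lemma \<open>constant_half_space_hyperplane_unique\<close>). So the hyperplanes are determined from the
  top of the flag downwards; the regions and weights follow up to the global sign
  (lemma \<open>encoding_unique\<close>). Every weighted flag occurs: the function that it
  prescribes is assembled along the flag, and the monotonicity of the weights gives the ultrametric
  inequality (lemma \<open>ex_signed_seminorm_up_to_level\<close>). Since the regions, their opposites and the
  smallest subspace cover \<open>W\<close>, a seminorm is determined up to homothety by its weighted flag.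

  The relation \<open>encoded_by\<close> is thus a correspondence that is total on both sides and whose fibres
  are exactly the equivalence classes on both sides. It therefore descends to a bijection of the quotients.\<close>

section \<open>Elementary properties of signed seminorms\<close>

lemma signed_seminorm_scaleR:
  assumes "signed_seminorm N"
  shows "N (a *\<^sub>R v) = sgn a * N v"
  using assms by (auto simp: signed_seminorm_def trivial_abs_def)

lemma signed_seminorm_zero:
  assumes "signed_seminorm N"
  shows "N 0 = 0"
  using signed_seminorm_scaleR[OF assms, of 0 0] by simp

lemma signed_seminorm_minus:
  assumes "signed_seminorm N"
  shows "N (- v) = - N v"
  using signed_seminorm_scaleR[OF assms, of "-1" v] by simp

lemma signed_seminorm_add_le:
  assumes "signed_seminorm N"
  shows "N (v + w) \<le> max (N v) (N w)"
  using assms by (auto simp: signed_seminorm_def)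

section \<open>The half-space on which a signed seminorm is maximal\<close>

text \<open>This is the supporting hyperplane theorem for the cone \<open>N v \<ge> 0\<close>, proved in the style of the
  Hahn-Banach theorem by adding one basis vector \<open>b\<close> at a time. If \<open>N (b - u)\<close> has the same strict
  sign for all \<open>u\<close> in the old span, then \<open>b\<close> lies above (or below) all of it, and the coordinate
  along \<open>b\<close> (or its negative) is the functional. Otherwise the old functional extends, with
  a value at \<open>b\<close> given by the cut that the sign of \<open>N (b - u)\<close> defines.\<close>

lemma signed_seminorm_positive_on_half_space_span:
  fixes N :: "'w::real_vector \<Rightarrow> real"
  assumes N: "signed_seminorm N"
    and "finite B" "independent B" "\<exists>v \<in> span B. N v \<noteq> 0"
  shows "\<exists>f :: 'w \<Rightarrow> real. linear f \<and> (\<exists>v \<in> span B. f v \<noteq> 0) \<and>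
    (\<forall>v \<in> span B. f v > 0 \<longrightarrow> N v > 0)"
  using assms(2-4)
proof (induction B rule: finite_induct)
  case empty
  then show ?case using signed_seminorm_zero[OF N] by simp
next
  case (insert b B)
  let ?U = "span B" and ?U' = "span (insert b B)"
  have indB: "independent B"
    using insert.prems(1) insert.hyps(2) by (auto simp: independent_insert)
  obtain g :: "'w \<Rightarrow> real" where g: "linear g"
    and gB: "\<forall>x \<in> insert b B. g x = (if x = b then 1 else 0)"
    using linear_independent_extend[OF insert.prems(1), of "\<lambda>x. if x = b then 1 else 0"] by blast
  have gb: "g b = 1" using gB by simp
  have gU: "g u = 0" if "u \<in> ?U" for u
  proof (rule linear_eq_0_on_span[OF g _ that])
    show "g x = 0" if "x \<in> B" for x using gB insert.hyps(2) that by auto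
  qed
  have bU': "b \<in> ?U'" by (simp add: span_base)
  have UU': "?U \<subseteq> ?U'" by (intro span_mono) auto
  \<comment> \<open>off the old span every vector is a multiple of some \<open>b - u\<close>, so only the signs of \<open>N (b - u)\<close> matter\<close>
  have decomp: "v \<in> ?U \<or> (\<exists>t u. t \<noteq> 0 \<and> u \<in> ?U \<and> v = t *\<^sub>R (b - u))" if v: "v \<in> ?U'" for v
  proof -
    obtain t where t: "v - t *\<^sub>R b \<in> ?U"
      using v span_breakdown_eq[of v b B] by auto
    show ?thesis
    proof (cases "t = 0")
      case True
      then show ?thesis using t by simp
    next
      case False
      let ?u = "(- 1 / t) *\<^sub>R (v - t *\<^sub>R b)"
      have "?u \<in> ?U" using t by (rule span_scale)
      moreover have "v = t *\<^sub>R (b - ?u)" using False by (simp add: algebra_simps)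
      ultimately show ?thesis using False by blast
    qed
  qed
  have g_scale: "g (t *\<^sub>R (b - u)) = t" if "u \<in> ?U" for t u
    using that gU gb by (simp add: linear_scale[OF g] linear_diff[OF g])
  consider (above) "\<forall>u \<in> ?U. N (b - u) > 0" | (below) "\<forall>u \<in> ?U. N (b - u) < 0"
    | (between) u0 u1 where "u0 \<in> ?U" "u1 \<in> ?U" "N (b - u0) \<le> 0" "N (b - u1) \<ge> 0"
    by (meson not_le)
  then show ?case
  proof cases
    case above
    have "N v > 0" if "v \<in> ?U'" "g v > 0" for v
      using decomp[OF that(1)] that(2) gU above g_scale
      by (auto simp: signed_seminorm_scaleR[OF N])
    then show ?thesis using g gb bU' by (intro exI[of _ g]) force
  next
    case below
    have "N v > 0" if "v \<in> ?U'" "- g v > 0" for v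
      using decomp[OF that(1)] that(2) gU below g_scale
      by (auto simp: signed_seminorm_scaleR[OF N] mult_neg_neg)
    moreover have "linear (\<lambda>v. - g v)" using g by (simp add: linear_compose_neg)
    ultimately show ?thesis using gb bU' by (intro exI[of _ "\<lambda>v. - g v"]) force
  next
    case between
    \<comment> \<open>if \<open>N\<close> vanished on the old span, the two inequalities would give \<open>N b = 0\<close>, so \<open>N\<close> would vanish on the new span\<close>
    have "\<exists>v \<in> ?U. N v \<noteq> 0"
    proof (rule ccontr)
      assume "\<not> ?thesis"
      then have zU: "N u = 0" if "u \<in> ?U" for u using that by blast
      have "N b \<le> 0"
        using signed_seminorm_add_le[OF N, of "b - u0" u0] between zU by simp
      moreover have "N (- b) \<le> 0"
        using signed_seminorm_add_le[OF N, of "- (b - u1)" "- u1"] between zU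
        by (simp add: signed_seminorm_minus[OF N] del: minus_diff_eq)
      ultimately have Nb: "N b = 0" by (simp add: signed_seminorm_minus[OF N])
      have "N (b - u) \<le> 0 \<and> N (- (b - u)) \<le> 0" if "u \<in> ?U" for u
        using signed_seminorm_add_le[OF N, of b "-u"] signed_seminorm_add_le[OF N, of "-b" u] zU[OF that]
        by (simp add: signed_seminorm_minus[OF N] Nb)
      then have "N (b - u) = 0" if "u \<in> ?U" for u
        using that signed_seminorm_minus[OF N, of "b - u"] by fastforce
      then have "N v = 0" if "v \<in> ?U'" for v
        using decomp[OF that] zU by (auto simp: signed_seminorm_scaleR[OF N])
      then show False using insert.prems(2) by blast
    qed
    then obtain f :: "'w \<Rightarrow> real" where f: "linear f" and fnz: "\<exists>v \<in> ?U. f v \<noteq> 0"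
      and fpos: "\<And>v. v \<in> ?U \<Longrightarrow> f v > 0 \<Longrightarrow> N v > 0"
      using insert.IH[OF indB] by blast
    have cross: "f u \<le> f u'" if u: "u \<in> ?U" "u' \<in> ?U" "N (b - u) \<ge> 0" "N (b - u') \<le> 0" for u u'
    proof (rule ccontr)
      assume "\<not> ?thesis"
      then have "f (u - u') > 0" by (simp add: linear_diff[OF f])
      then have "N (u - u') > 0" using fpos span_diff[OF u(1,2)] by blast
      moreover have "N (u - u') \<le> max (N (b - u')) (N (- (b - u)))"
        using signed_seminorm_add_le[OF N, of "b - u'" "- (b - u)"] by simp
      ultimately show False using u by (simp add: signed_seminorm_minus[OF N] del: minus_diff_eq)
    qed
    \<comment> \<open>the value at \<open>b\<close> of the extended functional is the supremum of the lower half of the cut\<close>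
    define L where "L = f ` {u \<in> ?U. N (b - u) \<ge> 0}"
    define s where "s = Sup L"
    have "L \<noteq> {}" using between by (auto simp: L_def)
    then have s_le: "s \<le> f u" if "u \<in> ?U" "N (b - u) \<le> 0" for u
      unfolding s_def using that cross by (intro cSup_least) (auto simp: L_def)
    have "bdd_above L"
      using cross[OF _ between(1) _ between(3)] by (auto simp: L_def intro!: bdd_aboveI)
    then have le_s: "f u \<le> s" if "u \<in> ?U" "N (b - u) \<ge> 0" for u
      unfolding s_def using that by (intro cSup_upper) (auto simp: L_def)
    define h where "h v = f v + (s - f b) * g v" for v
    have h: "linear h"
      unfolding h_def using f g by (auto simp: linear_iff algebra_simps)
    have h_scale: "h (t *\<^sub>R (b - u)) = t * (s - f u)" if "u \<in> ?U" for t u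
      unfolding h_def g_scale[OF that] linear_scale[OF f] linear_diff[OF f]
      by (simp add: algebra_simps)
    have "N v > 0" if v: "v \<in> ?U'" "h v > 0" for v
      using decomp[OF v(1)]
    proof
      assume "v \<in> ?U"
      then show ?thesis using fpos v(2) gU by (simp add: h_def)
    next
      assume "\<exists>t u. t \<noteq> 0 \<and> u \<in> ?U \<and> v = t *\<^sub>R (b - u)"
      then obtain t u where tu: "t \<noteq> 0" "u \<in> ?U" "v = t *\<^sub>R (b - u)" by blast
      then have "t * (s - f u) > 0" using v(2) h_scale by simp
      then have "t > 0 \<and> N (b - u) > 0 \<or> t < 0 \<and> N (b - u) < 0"
        using s_le[OF tu(2)] le_s[OF tu(2)] by (force simp: zero_less_mult_iff)
      then show ?thesis using tu by (auto simp: signed_seminorm_scaleR[OF N])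
    qed
    moreover have "\<exists>v \<in> ?U'. h v \<noteq> 0" 
  proof -
    obtain v where "v \<in> ?U" "f v \<noteq> 0" using fnz by blast
    then have "v \<in> ?U'" "h v \<noteq> 0" using UU' gU[of v] by (auto simp: h_def)
    then show ?thesis ..
  qed
    ultimately show ?thesis using h by blast
  qed
qed

lemma finite_basis_of_subspace:
  fixes U :: "'w::real_vector set"
  assumes "finite S" "span S = (UNIV :: 'w set)" "subspace U"
  obtains B where "finite B" "independent B" "span B = U" "card B = dim U"
proof -
  obtain B where B: "B \<subseteq> U" "independent B" "U \<subseteq> span B" "card B = dim U"
    using basis_exists by blast
  have "finite B" using independent_span_bound[OF assms(1) B(2)] assms(2) by simp
  moreover have "span B = U" using B assms(3) by (simp add: span_minimal subset_antisym)
  ultimately show ?thesis using that B by blast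
qed

lemma dim_kernel:
  fixes f :: "'w::real_vector \<Rightarrow> real"
  assumes fin: "finite S" "span S = (UNIV :: 'w set)"
    and U: "subspace U" and f: "linear f" and v: "v \<in> U" "f v \<noteq> 0"
  shows "dim U = Suc (dim {u \<in> U. f u = 0})"
proof -
  let ?K = "{u \<in> U. f u = 0}"
  have K: "subspace ?K"
    using U f by (auto simp: subspace_def linear_0 linear_add linear_scale)
  obtain B where B: "finite B" "independent B" "span B = ?K" "card B = dim ?K"
    using finite_basis_of_subspace[OF fin K] by blast
  have vB: "v \<notin> span B" using v B by auto
  have "span (insert v B) = U"
  proof
    have "B \<subseteq> U" using B(3) span_superset[of B] by blast
    then show "span (insert v B) \<subseteq> U" using v U by (intro span_minimal) auto
    show "U \<subseteq> span (insert v B)"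
    proof
      fix u assume u: "u \<in> U"
      have "u - (f u / f v) *\<^sub>R v \<in> ?K"
        using u v U by (simp add: linear_diff[OF f] linear_scale[OF f] subspace_diff subspace_scale)
      then show "u \<in> span (insert v B)" using B(3) span_breakdown_eq[of u v B] by auto
    qed
  qed
  moreover have "independent (insert v B)" using B vB by (simp add: independent_insert)
  ultimately have "dim U = card (insert v B)"
    using dim_span_eq_card_independent by metis
  moreover have "v \<notin> B" using vB span_base by blast
  ultimately show ?thesis using B by simp
qed

lemma open_half_space_functional:
  fixes U U' H :: "'w::real_vector set"
  assumes "open_half_space U U' H" "subspace U'" "U \<subset> U'"
  obtains f :: "'w \<Rightarrow> real" and y where "linear f" "U = {v \<in> U'. f v = 0}"
    "H = {v \<in> U'. f v > 0}" "y \<in> H"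
proof -
  obtain f :: "'w \<Rightarrow> real" where f: "linear f" "U = {v \<in> U'. f v = 0}" "H = {v \<in> U'. f v > 0}"
    using assms(1) by (auto simp: open_half_space_def)
  obtain v where v: "v \<in> U'" "f v \<noteq> 0" using assms(3) f by blast
  have "v \<in> H \<or> - v \<in> H"
    using v assms(2) f by (auto simp: linear_neg subspace_neg)
  then show ?thesis using that f by blast
qed

text \<open>The key estimate is that \<open>f v < f w\<close> and \<open>f w > 0\<close> imply \<open>N v \<le> N w\<close>: here \<open>f (w - v) > 0\<close>,
  so \<open>N (v - w) < 0\<close> and \<open>N v \<le> max (N w) (N (v - w)) = N w\<close>. Constancy on the half-space follows
  because \<open>v\<close> can be shrunk until \<open>f v < f w\<close> without changing \<open>N v\<close>.\<close>

lemma signed_seminorm_maximal_half_space: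
  fixes N :: "'w::real_vector \<Rightarrow> real"
  assumes N: "signed_seminorm N" and fin: "finite S" "span S = (UNIV :: 'w set)"
    and U: "subspace U" and nz: "\<exists>v \<in> U. N v \<noteq> 0"
  obtains U' H c y where "subspace U'" "U' \<subset> U" "dim U = Suc (dim U')" "open_half_space U' U H"
    "c > 0" "\<And>v. v \<in> H \<Longrightarrow> N v = c" "\<And>v. v \<in> U' \<Longrightarrow> N v \<le> c" "y \<in> H"
proof -
  obtain B where B: "finite B" "independent B" "span B = U"
    using finite_basis_of_subspace[OF fin U] by blast
  obtain f :: "'w \<Rightarrow> real" where f: "linear f" and fnz: "\<exists>v \<in> U. f v \<noteq> 0"
    and fpos: "\<And>v. v \<in> U \<Longrightarrow> f v > 0 \<Longrightarrow> N v > 0"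
    using signed_seminorm_positive_on_half_space_span[OF N B(1,2)] nz B(3) by auto
  define U' where "U' = {v \<in> U. f v = 0}"
  define H where "H = {v \<in> U. f v > 0}"
  have half: "open_half_space U' U H"
    using f by (auto simp: open_half_space_def U'_def H_def)
  have sub: "subspace U'"
    using U f by (auto simp: U'_def subspace_def linear_0 linear_add linear_scale)
  have strict: "U' \<subset> U" using fnz by (auto simp: U'_def)
  have mono: "N v \<le> N w" if vw: "v \<in> U" "w \<in> U" "f v < f w" "f w > 0" for v w
  proof -
    have "N (w - v) > 0"
      using fpos[of "w - v"] vw U by (simp add: linear_diff[OF f] subspace_diff)
    then have "N (- (w - v)) < 0" by (simp add: signed_seminorm_minus[OF N] del: minus_diff_eq)
    moreover have "N v \<le> max (N w) (N (- (w - v)))"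
      using signed_seminorm_add_le[OF N, of w "- (w - v)"] by simp
    moreover have "N w > 0" using fpos vw by blast
    ultimately show ?thesis by linarith
  qed
  have le: "N v \<le> N w" if "v \<in> H" "w \<in> H" for v w
  proof -
    have v: "v \<in> U" "f v > 0" and w: "w \<in> U" "f w > 0" using that by (auto simp: H_def)
    define t where "t = f w / (2 * f v)"
    have t: "t > 0" using v w by (simp add: t_def)
    have "f (t *\<^sub>R v) < f w" using v w by (simp add: t_def linear_scale[OF f])
    then have "N (t *\<^sub>R v) \<le> N w" using mono v w U by (simp add: subspace_scale)
    then show ?thesis using t by (simp add: signed_seminorm_scaleR[OF N])
  qed
  obtain y where y: "y \<in> H" using open_half_space_functional[OF half U strict] by blast
  have "dim U = Suc (dim U')"
    using fnz dim_kernel[OF fin U f] unfolding U'_def by blast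
  moreover have "N y > 0" using y fpos by (simp add: H_def)
  moreover have "N v = N y" if "v \<in> H" for v using le that y by (simp add: antisym)
  moreover have "N v \<le> N y" if "v \<in> U'" for v
    using mono[of v y] that y by (auto simp: H_def U'_def)
  ultimately show ?thesis using that sub strict half y by blast
qed

section \<open>Signed flags of a subspace\<close>

text \<open>Allowing an arbitrary top \<open>U\<close> and length zero makes induction along the flag possible:
  removing the top of a signed flag of \<open>U\<close> leaves a signed flag of a hyperplane of \<open>U\<close>, and the zero
  seminorm belongs to the flag of length zero.\<close>

definition subspace_flag :: "'w::real_vector set \<Rightarrow> 'w set list \<Rightarrow> 'w set list \<Rightarrow> bool" where
  "subspace_flag U Vs Hs \<longleftrightarrow> length Vs = length Hs + 1 \<and> (\<forall>W \<in> set Vs. subspace W) \<and> last Vs = U \<and>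
     (\<forall>i < length Hs. Vs ! i \<subset> Vs ! (i + 1) \<and> dim (Vs ! i) = dim (Vs ! (i + 1)) - 1 \<and>
        open_half_space (Vs ! i) (Vs ! (i + 1)) (Hs ! i))"

lemma signed_flags_iff:
  "(Vs, Hs) \<in> signed_flags \<longleftrightarrow> length Hs \<ge> 1 \<and> subspace_flag UNIV Vs Hs"
  by (auto simp: signed_flags_def subspace_flag_def)

lemma subspace_flag_subspace:
  "subspace_flag U Vs Hs \<Longrightarrow> k \<le> length Hs \<Longrightarrow> subspace (Vs ! k)"
  by (simp add: subspace_flag_def)

lemma subspace_flag_top:
  assumes "subspace_flag U Vs Hs"
  shows "Vs ! length Hs = U"
proof -
  have "length Vs = Suc (length Hs)" "last Vs = U" using assms by (auto simp: subspace_flag_def)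
  then show ?thesis by (metis diff_Suc_1 last_conv_nth list.size(3) nat.distinct(1))
qed

lemma subspace_flag_mono:
  assumes "subspace_flag U Vs Hs" "i \<le> j" "j \<le> length Hs"
  shows "Vs ! i \<subseteq> Vs ! j"
  using assms(2,3)
proof (induction j rule: dec_induct)
  case (step m)
  then have "Vs ! i \<subseteq> Vs ! m" by simp
  also have "Vs ! m \<subseteq> Vs ! Suc m" using step.prems assms(1) by (simp add: subspace_flag_def psubset_imp_subset)
  finally show ?case .
qed simp

lemma subspace_flag_functional:
  fixes Vs :: "'w::real_vector set list"
  assumes "subspace_flag U Vs Hs" "i < length Hs"
  obtains f :: "'w \<Rightarrow> real" and y where "linear f" "Vs ! i = {v \<in> Vs ! Suc i. f v = 0}"
    "Hs ! i = {v \<in> Vs ! Suc i. f v > 0}" "y \<in> Hs ! i"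
proof (rule open_half_space_functional)
  show "open_half_space (Vs ! i) (Vs ! Suc i) (Hs ! i)" "Vs ! i \<subset> Vs ! Suc i"
    using assms by (simp_all add: subspace_flag_def)
  show "subspace (Vs ! Suc i)" using subspace_flag_subspace[OF assms(1)] assms(2) by simp
qed (rule that)

lemma subspace_flag_region_nonempty:
  assumes "subspace_flag U Vs Hs" "i < length Hs"
  shows "\<exists>y. y \<in> Hs ! i \<and> y \<in> Vs ! Suc i"
  by (rule subspace_flag_functional[OF assms]) blast

lemma subspace_flag_snoc:
  assumes "subspace_flag U' Vs Hs" "subspace U" "U' \<subset> U" "dim U' = dim U - 1"
    "open_half_space U' U H"
  shows "subspace_flag U (Vs @ [U]) (Hs @ [H])"
proof -
  have len: "length Vs = Suc (length Hs)" and sub: "\<forall>W \<in> set Vs. subspace W"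
    and step: "\<And>i. i < length Hs \<Longrightarrow> Vs ! i \<subset> Vs ! Suc i \<and>
      dim (Vs ! i) = dim (Vs ! Suc i) - 1 \<and> open_half_space (Vs ! i) (Vs ! Suc i) (Hs ! i)"
    using assms(1) by (simp_all add: subspace_flag_def)
  have "(Vs @ [U]) ! i \<subset> (Vs @ [U]) ! (i + 1) \<and>
      dim ((Vs @ [U]) ! i) = dim ((Vs @ [U]) ! (i + 1)) - 1 \<and>
      open_half_space ((Vs @ [U]) ! i) ((Vs @ [U]) ! (i + 1)) ((Hs @ [H]) ! i)"
    if "i < length (Hs @ [H])" for i
  proof (cases "i = length Hs")
    case True
    then show ?thesis
      using assms(3-5) subspace_flag_top[OF assms(1)] len by (simp add: nth_append)
  next
    case False
    then show ?thesis using that step[of i] len by (simp add: nth_append)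
  qed
  then show ?thesis using len sub assms(2) unfolding subspace_flag_def by simp
qed

text \<open>The regions, their opposites and the smallest subspace cover the top, because each step \<open>V\<^sub>i\<^sub>+\<^sub>1\<close>
  is the union of \<open>V\<^sub>i\<close> and the two sides of it.\<close>

lemma subspace_flag_cases:
  assumes flag: "subspace_flag U Vs Hs" and "v \<in> U"
  obtains "v \<in> Vs ! 0" | i where "i < length Hs" "v \<in> Hs ! i \<or> - v \<in> Hs ! i"
proof -
  have "v \<in> Vs ! 0 \<or> (\<exists>i < k. v \<in> Hs ! i \<or> - v \<in> Hs ! i)"
    if "k \<le> length Hs" "v \<in> Vs ! k" for k
    using that
  proof (induction k)
    case (Suc k)
    have k: "k < length Hs" using Suc.prems by simp
    obtain f :: "'a \<Rightarrow> real" and y where f: "linear f" "Vs ! k = {v \<in> Vs ! Suc k. f v = 0}"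
        "Hs ! k = {v \<in> Vs ! Suc k. f v > 0}" and "y \<in> Hs ! k"
      by (rule subspace_flag_functional[OF flag k])
    have "- v \<in> Vs ! Suc k"
      using Suc.prems subspace_flag_subspace[OF flag] by (simp add: subspace_neg)
    then have "v \<in> Vs ! k \<or> v \<in> Hs ! k \<or> - v \<in> Hs ! k"
      using Suc.prems unfolding f(2,3) by (auto simp: linear_neg[OF f(1)])
    moreover have "v \<in> Vs ! k \<Longrightarrow> v \<in> Vs ! 0 \<or> (\<exists>i < k. v \<in> Hs ! i \<or> - v \<in> Hs ! i)"
      using Suc.IH k by simp
    ultimately show ?case using less_Suc_eq by blast
  qed simp
  then have "v \<in> Vs ! 0 \<or> (\<exists>i < length Hs. v \<in> Hs ! i \<or> - v \<in> Hs ! i)"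
    using assms(2) subspace_flag_top[OF flag] by simp
  then show ?thesis using that by blast
qed

text \<open>The unnormalised form of \<open>encoded_by\<close>, in which the list contains the values of the function
  instead of weights up to a common factor.\<close>

definition level_values :: "('w \<Rightarrow> real) \<Rightarrow> 'w set list \<Rightarrow> 'w set list \<Rightarrow> real list \<Rightarrow> bool" where
  "level_values N Vs Hs es \<longleftrightarrow>
     (\<forall>v \<in> Vs ! 0. N v = 0) \<and> (\<forall>i < length Hs. \<forall>v \<in> Hs ! i. N v = es ! i)"

lemma encoded_by_iff_level_values:
  assumes "length (snd F) = length ds + 1"
  shows "encoded_by N F ds \<longleftrightarrow>
    (\<exists>c. c \<noteq> 0 \<and> level_values N (fst F) (snd F) (map ((*) c) (ds @ [1])))"
  using assms by (auto simp: encoded_by_def level_values_def nth_append)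

section \<open>The weighted flag of a signed seminorm\<close>

text \<open>Induction on the dimension: the maximal half-space provides the top step of the flag. That the
  values are attained on \<open>U\<close> is part of the induction, since it is what bounds them by the
  maximal value of the next step and so keeps the list sorted.\<close>

lemma ex_flag_with_level_values:
  fixes N :: "'w::real_vector \<Rightarrow> real"
  assumes N: "signed_seminorm N" and fin: "finite S" "span S = (UNIV :: 'w set)"
    and U: "subspace U"
  shows "\<exists>Vs Hs es. subspace_flag U Vs Hs \<and> level_values N Vs Hs es \<and> length es = length Hs \<and>
    sorted es \<and> (\<forall>e \<in> set es. e > 0 \<and> e \<in> N ` U)"
  using U
proof (induction "dim U" arbitrary: U rule: less_induct)
  case less
  show ?case
  proof (cases "\<exists>v \<in> U. N v \<noteq> 0")
    case False
    then have "subspace_flag U [U] []" "level_values N [U] [] []"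
      using less.prems by (auto simp: subspace_flag_def level_values_def)
    then show ?thesis by (intro exI[of _ "[U]"] exI[of _ "[]"]) auto
  next
    case True
    obtain U' H c y where sub: "subspace U'" "U' \<subset> U" and dim: "dim U = Suc (dim U')"
      and half: "open_half_space U' U H"
      and c: "c > 0" "\<And>v. v \<in> H \<Longrightarrow> N v = c" "\<And>v. v \<in> U' \<Longrightarrow> N v \<le> c" and y: "y \<in> H"
      using signed_seminorm_maximal_half_space[OF N fin less.prems True] by metis
    obtain Vs Hs es where flag: "subspace_flag U' Vs Hs" and lev: "level_values N Vs Hs es"
      and es: "length es = length Hs" "sorted es" "\<forall>e \<in> set es. e > 0 \<and> e \<in> N ` U'"
      using less.hyps[of U'] sub dim by auto
    have "subspace_flag U (Vs @ [U]) (Hs @ [H])"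
      using subspace_flag_snoc[OF flag less.prems sub(2) _ half] dim by simp
    moreover have "level_values N (Vs @ [U]) (Hs @ [H]) (es @ [c])"
    proof -
      have "Vs \<noteq> []" using flag by (auto simp: subspace_flag_def)
      then have "(Vs @ [U]) ! 0 = Vs ! 0" by (simp add: nth_append)
      then show ?thesis using lev es(1) c(2) by (auto simp: level_values_def nth_append less_Suc_eq)
    qed
    moreover have "sorted (es @ [c])" using es c(3) by (auto simp: sorted_append)
    moreover have "c \<in> N ` U" using y half c(2) by (force simp: open_half_space_def)
    then have "\<forall>e \<in> set (es @ [c]). e > 0 \<and> e \<in> N ` U" using es(3) c(1) sub(2) by auto
    ultimately show ?thesis using es(1) by (metis length_append_singleton)
  qed
qed

lemma ex_encoding:
  fixes N :: "'w::real_vector \<Rightarrow> real"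
  assumes N: "N \<in> nonzero_signed_seminorms" and fin: "finite S" "span S = (UNIV :: 'w set)"
  shows "\<exists>(F, ds) \<in> weighted_signed_flags. encoded_by N F ds"
proof -
  have sn: "signed_seminorm N" and nz: "\<exists>v. N v \<noteq> 0"
    using N by (auto simp: nonzero_signed_seminorms_def)
  obtain Vs Hs es where flag: "subspace_flag UNIV Vs Hs" and lev: "level_values N Vs Hs es"
    and es: "length es = length Hs" "sorted es" "\<forall>e \<in> set es. e > 0"
    using ex_flag_with_level_values[OF sn fin subspace_UNIV] by metis
  have "Hs \<noteq> []"
    using lev nz subspace_flag_top[OF flag] by (auto simp: level_values_def)
  then have len: "length Hs \<ge> 1" by (simp add: Suc_le_eq)
  from \<open>Hs \<noteq> []\<close> es(1) obtain xs c where es_eq: "es = xs @ [c]" by (metis length_0_conv rev_exhaust)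
  define ds where "ds = map (\<lambda>e. e / c) xs"
  have c: "c > 0" and pos: "\<forall>e \<in> set xs. e > 0" and le: "\<forall>e \<in> set xs. e \<le> c"
    and srt: "sorted xs"
    using es(2,3) unfolding es_eq by (auto simp: sorted_append)
  have es_map: "map ((*) c) (ds @ [1]) = es"
    using c unfolding es_eq by (simp add: ds_def o_def)
  have lds: "length (snd (Vs, Hs)) = length ds + 1" using es(1) unfolding es_eq by (simp add: ds_def)
  have "c \<noteq> 0 \<and> level_values N (fst (Vs, Hs)) (snd (Vs, Hs)) (map ((*) c) (ds @ [1]))"
    unfolding es_map using c lev by simp
  then have enc: "encoded_by N (Vs, Hs) ds"
    unfolding encoded_by_iff_level_values[OF lds] by (rule exI)
  have "sorted ds"
    using srt c by (auto simp: ds_def sorted_iff_nth_mono divide_right_mono)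
  then have "((Vs, Hs), ds) \<in> weighted_signed_flags"
    using flag len lds c pos le
    by (auto simp: weighted_signed_flags_def flag_weights_def signed_flags_iff ds_def)
  then show ?thesis using enc by blast
qed

section \<open>Uniqueness of the weighted flag\<close>

text \<open>A vector \<open>x\<close> in \<open>U\<^sub>1\<close> but not in \<open>U\<^sub>2\<close> can be added in any multiple to a point \<open>y\<close> of \<open>H\<^sub>1\<close> without
  leaving \<open>H\<^sub>1\<close>, while the functional that cuts out \<open>U\<^sub>2\<close> takes all real values along that line.
  So \<open>N = c\<^sub>1\<close> at points of both \<open>H\<^sub>2\<close> and its opposite, which is impossible for an odd \<open>N\<close> and \<open>c\<^sub>1 \<noteq> 0\<close>.\<close>

lemma constant_half_space_hyperplane_unique:
  fixes N :: "'w::real_vector \<Rightarrow> real"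
  assumes N: "\<And>v. N (- v) = - N v" and U: "subspace U"
    and half1: "open_half_space U1 U H1" "U1 \<subset> U" "\<forall>v \<in> H1. N v = c1" "c1 \<noteq> 0"
    and half2: "open_half_space U2 U H2" "\<forall>v \<in> H2. N v = c2"
  shows "U1 \<subseteq> U2"
proof (rule ccontr)
  assume "\<not> ?thesis"
  then obtain x where x: "x \<in> U1" "x \<notin> U2" by blast
  obtain f :: "'w \<Rightarrow> real" and y where f: "linear f" "U1 = {v \<in> U. f v = 0}"
    "H1 = {v \<in> U. f v > 0}" and y: "y \<in> H1"
    using open_half_space_functional[OF half1(1) U half1(2)] by blast
  obtain g :: "'w \<Rightarrow> real" where g: "linear g" "U2 = {v \<in> U. g v = 0}" "H2 = {v \<in> U. g v > 0}"
    using half2(1) by (auto simp: open_half_space_def)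
  have gx: "g x \<noteq> 0" using x f g by blast
  \<comment> \<open>the point of the line at which \<open>g\<close> has the value \<open>s\<close>\<close>
  define z where "z s = y + ((s - g y) / g x) *\<^sub>R x" for s
  have zU: "z s \<in> U" for s using x y f U by (auto simp: z_def subspace_add subspace_scale)
  have "f (z s) = f y" for s using x f by (simp add: z_def linear_add linear_scale)
  then have z1: "N (z s) = c1" for s using half1(3) zU y f by simp
  have gz: "g (z s) = s" for s using gx by (simp add: z_def linear_add[OF g(1)] linear_scale[OF g(1)])
  have "N (z 1) = c2" using half2(2) g zU gz by simp
  moreover have "N (- z (- 1)) = c2"
    using half2(2) g zU gz U by (simp add: linear_neg subspace_neg)
  ultimately show False using z1 N half1(4) by (metis neg_equal_zero)
qed

text \<open>Positions are counted from the top, where the two flags are known to agree; that they have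
  the same length is only a consequence.\<close>

lemma flags_agree_from_top:
  fixes N :: "'w::real_vector \<Rightarrow> real"
  assumes N: "\<And>v. N (- v) = - N v"
    and F: "subspace_flag U Vs Hs" "level_values N Vs Hs es" "\<forall>i < length Hs. es ! i \<noteq> 0"
    and G: "subspace_flag U Ws Gs" "level_values N Ws Gs es'" "\<forall>i < length Gs. es' ! i \<noteq> 0"
    and "k \<le> length Hs" "k \<le> length Gs"
  shows "Vs ! (length Hs - k) = Ws ! (length Gs - k)"
  using assms(8,9)
proof (induction k)
  case 0
  then show ?case by (simp add: subspace_flag_top[OF F(1)] subspace_flag_top[OF G(1)])
next
  case (Suc k)
  define i where "i = length Hs - Suc k"
  define j where "j = length Gs - Suc k"
  have i: "i < length Hs" "length Hs - k = Suc i" and j: "j < length Gs" "length Gs - k = Suc j"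
    using Suc.prems by (auto simp: i_def j_def)
  have eq: "Ws ! Suc j = Vs ! Suc i" using Suc i j by simp
  have sub: "subspace (Vs ! Suc i)" using subspace_flag_subspace[OF F(1)] i by simp
  have i': "open_half_space (Vs ! i) (Vs ! Suc i) (Hs ! i)" "Vs ! i \<subset> Vs ! Suc i"
      "\<forall>v \<in> Hs ! i. N v = es ! i" "es ! i \<noteq> 0"
    using F i by (auto simp: subspace_flag_def level_values_def)
  have j': "open_half_space (Ws ! j) (Vs ! Suc i) (Gs ! j)" "Ws ! j \<subset> Vs ! Suc i"
      "\<forall>v \<in> Gs ! j. N v = es' ! j" "es' ! j \<noteq> 0"
    using G j unfolding eq[symmetric] by (auto simp: subspace_flag_def level_values_def)
  show ?case
    using constant_half_space_hyperplane_unique[where N = N, OF N sub i' j'(1,3)]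
      constant_half_space_hyperplane_unique[where N = N, OF N sub j' i'(1,3)]
    by (simp add: i_def j_def)
qed

text \<open>If the second flag were longer, then the smallest subspace of the first, on which \<open>N\<close> vanishes,
  would be a member \<open>V\<^sub>j\<^sub>+\<^sub>1\<close> of the second that contains a region with a nonzero value.\<close>

lemma flag_length_le:
  fixes N :: "'w::real_vector \<Rightarrow> real"
  assumes N: "\<And>v. N (- v) = - N v"
    and F: "subspace_flag U Vs Hs" "level_values N Vs Hs es" "\<forall>i < length Hs. es ! i \<noteq> 0"
    and G: "subspace_flag U Ws Gs" "level_values N Ws Gs es'" "\<forall>i < length Gs. es' ! i \<noteq> 0"
  shows "length Gs \<le> length Hs"
proof (rule ccontr)
  assume "\<not> ?thesis"
  then have less: "length Hs < length Gs" by simp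
  define j where "j = length Gs - Suc (length Hs)"
  have j: "j < length Gs" "length Gs - length Hs = Suc j" using less by (auto simp: j_def)
  have eq: "Vs ! 0 = Ws ! Suc j"
    using flags_agree_from_top[OF N F G, of "length Hs"] less j by simp
  obtain y where "y \<in> Gs ! j" "y \<in> Ws ! Suc j"
    using subspace_flag_region_nonempty[OF G(1) j(1)] by blast
  then have "N y = 0" "N y = es' ! j"
    using eq F(2) G(2) j by (auto simp: level_values_def)
  then show False using G(3) j by simp
qed

text \<open>Once the subspaces are known, the chosen side is recovered from the sign of \<open>N\<close>. The factor \<open>s\<close>
  accounts for a negative scaling constant in \<open>encoded_by\<close>.\<close>

lemma half_space_eq_sign_region:
  fixes N :: "'w::real_vector \<Rightarrow> real"
  assumes N: "\<And>v. N (- v) = - N v" and U: "subspace U'" and half: "open_half_space U U' H"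
    and e: "\<And>v. v \<in> H \<Longrightarrow> N v = e" "s * e > 0"
  shows "H = {v \<in> U' - U. s * N v > 0}"
proof -
  obtain f :: "'w \<Rightarrow> real" where f: "linear f" "U = {v \<in> U'. f v = 0}" "H = {v \<in> U'. f v > 0}"
    using half by (auto simp: open_half_space_def)
  have "f v > 0" if v: "v \<in> U'" "v \<notin> U" "s * N v > 0" for v
  proof (rule ccontr)
    assume "\<not> f v > 0"
    then have "- v \<in> H" using v f U by (auto simp: linear_neg subspace_neg)
    then have "- N v = e" using e(1) N by metis
    then show False using e(2) v(3) by (metis minus_mult_minus mult_minus_right neg_0_less_iff_less not_less_iff_gr_or_eq)
  qed
  moreover have "s * N v > 0" if "v \<in> H" for v using e that by simp
  ultimately show ?thesis using f by auto
qed

lemma uminus_sign_region: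
  fixes N :: "'w::real_vector \<Rightarrow> real"
  assumes N: "\<And>v. N (- v) = - N v" and U: "subspace U" and U': "subspace U'"
  shows "uminus ` {v \<in> U' - U. s * N v > 0} = {v \<in> U' - U. - s * N v > 0}"
proof -
  have "v \<in> uminus ` A \<longleftrightarrow> - v \<in> A" for v :: 'w and A by force
  moreover have "- v \<in> U \<longleftrightarrow> v \<in> U" "- v \<in> U' \<longleftrightarrow> v \<in> U'" for v
    using subspace_neg[OF U, of v] subspace_neg[OF U, of "-v"]
      subspace_neg[OF U', of v] subspace_neg[OF U', of "-v"] by auto
  ultimately show ?thesis by (simp add: set_eq_iff N)
qed

text \<open>The scaling constants \<open>c\<close> and \<open>c'\<close> of the two encodings are compared last: equal signs make the regions
  agree, opposite signs exchange all of them at once, and the top weight, which is \<open>1\<close> in both cases,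
  gives \<open>\<bar>c\<bar> = \<bar>c'\<bar>\<close> and with it the equality of the other weights.\<close>

lemma encoding_unique:
  fixes N :: "'w::real_vector \<Rightarrow> real"
  assumes N: "\<And>v. N (- v) = - N v"
    and F: "(F, ds) \<in> weighted_signed_flags" "encoded_by N F ds"
    and G: "(G, ds') \<in> weighted_signed_flags" "encoded_by N G ds'"
  shows "(F, G) \<in> flag_equiv \<and> ds = ds'"
proof -
  obtain Vs Hs where F_eq: "F = (Vs, Hs)" by fastforce
  obtain Ws Gs where G_eq: "G = (Ws, Gs)" by fastforce
  have flF: "subspace_flag UNIV Vs Hs" and lF: "length Hs = length ds + 1"
    and dF: "\<forall>d \<in> set (ds @ [1]). d > 0"
    using F(1) by (auto simp: weighted_signed_flags_def flag_weights_def signed_flags_iff F_eq)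
  have flG: "subspace_flag UNIV Ws Gs" and lG: "length Gs = length ds' + 1"
    and dG: "\<forall>d \<in> set (ds' @ [1]). d > 0"
    using G(1) by (auto simp: weighted_signed_flags_def flag_weights_def signed_flags_iff G_eq)
  obtain c where c: "c \<noteq> 0" and levF: "level_values N Vs Hs (map ((*) c) (ds @ [1]))"
    using F(2) encoded_by_iff_level_values[of F ds N] lF by (auto simp: F_eq)
  obtain c' where c': "c' \<noteq> 0" and levG: "level_values N Ws Gs (map ((*) c') (ds' @ [1]))"
    using G(2) encoded_by_iff_level_values[of G ds' N] lG by (auto simp: G_eq)
  have posF: "(ds @ [1]) ! i > 0" if "i < length Hs" for i
    using dF that lF by (metis One_nat_def length_append length_Cons list.size(3) nth_mem)
  have posG: "(ds' @ [1]) ! i > 0" if "i < length Gs" for i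
    using dG that lG by (metis One_nat_def length_append length_Cons list.size(3) nth_mem)
  have nzF: "\<forall>i < length Hs. map ((*) c) (ds @ [1]) ! i \<noteq> 0"
    using posF c lF by (auto simp del: map_append) (metis less_irrefl)
  have nzG: "\<forall>i < length Gs. map ((*) c') (ds' @ [1]) ! i \<noteq> 0"
    using posG c' lG by (auto simp del: map_append) (metis less_irrefl)
  have len: "length Gs = length Hs"
    using flag_length_le[OF N flF levF nzF flG levG nzG] flag_length_le[OF N flG levG nzG flF levF nzF]
    by simp
  have Vs_eq: "Vs = Ws"
  proof (rule nth_equalityI)
    show "length Vs = length Ws" using flF flG len by (simp add: subspace_flag_def)
    fix i assume "i < length Vs"
    then have "i \<le> length Hs" using flF by (simp add: subspace_flag_def)
    then show "Vs ! i = Ws ! i"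
      using flags_agree_from_top[OF N flF levF nzF flG levG nzG, of "length Hs - i"] len by simp
  qed
  define R where "R s i = {v \<in> Vs ! Suc i - Vs ! i. s * N v > 0}" for s i
  have valF: "N v = c * (ds @ [1]) ! i" if "i < length Hs" "v \<in> Hs ! i" for i v
    using levF that lF by (simp add: level_values_def del: map_append)
  have valG: "N v = c' * (ds' @ [1]) ! i" if "i < length Hs" "v \<in> Gs ! i" for i v
    using levG that lG len by (simp add: level_values_def del: map_append)
  have HsR: "Hs ! i = R (sgn c) i" if i: "i < length Hs" for i
    unfolding R_def
  proof (rule half_space_eq_sign_region[where e = "c * (ds @ [1]) ! i"])
    show "N (- v) = - N v" "v \<in> Hs ! i \<Longrightarrow> N v = c * (ds @ [1]) ! i" for v
      using N valF[OF i] by auto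
    show "subspace (Vs ! Suc i)" using subspace_flag_subspace[OF flF] i by simp
    show "open_half_space (Vs ! i) (Vs ! Suc i) (Hs ! i)" using flF i by (simp add: subspace_flag_def)
    show "0 < sgn c * (c * (ds @ [1]) ! i)" using c posF[OF i] by (auto simp: sgn_if mult_neg_pos)
  qed
  have GsR: "Gs ! i = R (sgn c') i" if i: "i < length Hs" for i
    unfolding R_def
  proof (rule half_space_eq_sign_region[where e = "c' * (ds' @ [1]) ! i"])
    show "N (- v) = - N v" "v \<in> Gs ! i \<Longrightarrow> N v = c' * (ds' @ [1]) ! i" for v
      using N valG[OF i] by auto
    show "subspace (Vs ! Suc i)" using subspace_flag_subspace[OF flF] i by simp
    show "open_half_space (Vs ! i) (Vs ! Suc i) (Gs ! i)"
      using flG i len by (simp add: subspace_flag_def Vs_eq)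
    show "0 < sgn c' * (c' * (ds' @ [1]) ! i)" using c' posG[of i] i len by (auto simp: sgn_if mult_neg_pos)
  qed
  have R_neg: "uminus ` R s i = R (- s) i" if "i < length Hs" for s i
    unfolding R_def using subspace_flag_subspace[OF flF] that by (intro uminus_sign_region N) auto
  have "sgn c' = sgn c \<or> sgn c' = - sgn c" using c c' by (auto simp: sgn_if)
  then have Gs_eq: "Gs = Hs \<or> Gs = map ((`) uminus) Hs"
  proof
    assume "sgn c' = sgn c"
    then have "Gs = Hs" using len HsR GsR by (intro nth_equalityI) auto
    then show ?thesis ..
  next
    assume "sgn c' = - sgn c"
    then have "Gs = map ((`) uminus) Hs"
      using len HsR GsR R_neg by (intro nth_equalityI) auto
    then show ?thesis ..
  qed
  have abs_eq: "\<bar>c\<bar> * (ds @ [1]) ! i = \<bar>c'\<bar> * (ds' @ [1]) ! i" if i: "i < length Hs" for i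
  proof -
    obtain y where y: "y \<in> Hs ! i" using subspace_flag_region_nonempty[OF flF i] by blast
    have "y \<in> Gs ! i \<or> - y \<in> Gs ! i" using Gs_eq y i by auto
    then have "\<bar>N y\<bar> = \<bar>c' * (ds' @ [1]) ! i\<bar>" using valG[OF i] N by (metis abs_minus_cancel)
    moreover have "\<bar>N y\<bar> = \<bar>c * (ds @ [1]) ! i\<bar>" using valF[OF i y] by simp
    ultimately show ?thesis using posF[OF i] posG[of i] i len by (simp add: abs_mult)
  qed
  have ds_len: "length ds = length ds'" using lF lG len by simp
  have "\<bar>c\<bar> = \<bar>c'\<bar>" using abs_eq[of "length ds"] lF ds_len by (simp add: nth_append)
  then have "ds ! i = ds' ! i" if "i < length ds" for i
    using abs_eq[of i] that lF ds_len c' by (simp add: nth_append)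
  then have "ds = ds'" using ds_len by (rule nth_equalityI[rotated])
  moreover have "F \<in> signed_flags" "G \<in> signed_flags"
    using F(1) G(1) by (auto simp: weighted_signed_flags_def)
  ultimately show ?thesis using Gs_eq by (auto simp: flag_equiv_def F_eq G_eq Vs_eq)
qed

lemma encoded_by_flag_equiv:
  assumes N: "\<And>v. N (- v) = - N v" and "(F, G) \<in> flag_equiv" "encoded_by N F ds"
  shows "encoded_by N G ds"
proof -
  obtain c where c: "c \<noteq> 0" and lev: "\<forall>i < length (snd F). \<forall>v \<in> snd F ! i. N v = c * (ds @ [1]) ! i"
    and zero: "\<forall>v \<in> fst F ! 0. N v = 0"
    using assms(3) by (auto simp: encoded_by_def)
  have "fst G = fst F" and "snd G = snd F \<or> snd G = map ((`) uminus) (snd F)"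
    using assms(2) by (auto simp: flag_equiv_def)
  then show ?thesis
  proof (elim disjE)
    assume "snd G = map ((`) uminus) (snd F)"
    then have "\<forall>i < length (snd G). \<forall>v \<in> snd G ! i. N v = (- c) * (ds @ [1]) ! i"
      using lev by (auto simp: N)
    then show ?thesis
      using c zero \<open>fst G = fst F\<close> unfolding encoded_by_def by (metis neg_equal_0_iff_equal)
  qed (use assms(3) in \<open>auto simp: encoded_by_def\<close>)
qed

lemma encoded_by_homothety:
  assumes "(N, M) \<in> homothety" "encoded_by N F ds"
  shows "encoded_by M F ds"
proof -
  obtain a where a: "a \<noteq> 0" "\<And>v. M v = a * N v" using assms(1) by (auto simp: homothety_def)
  obtain c where "c \<noteq> 0" "\<forall>i < length (snd F). \<forall>v \<in> snd F ! i. N v = c * (ds @ [1]) ! i"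
    "\<forall>v \<in> fst F ! 0. N v = 0"
    using assms(2) by (auto simp: encoded_by_def)
  then show ?thesis using a by (auto simp: encoded_by_def intro!: exI[of _ "a * c"])
qed

text \<open>On every region the ratio of the two seminorms is the ratio of their scaling constants, whatever
  the weight is; oddness carries this over to the opposite regions.\<close>

lemma encoded_by_imp_homothety:
  assumes N: "N \<in> nonzero_signed_seminorms" "encoded_by N F ds"
    and M: "M \<in> nonzero_signed_seminorms" "encoded_by M F ds"
    and F: "F \<in> signed_flags"
  shows "(N, M) \<in> homothety"
proof -
  have flag: "subspace_flag UNIV (fst F) (snd F)"
    using F signed_flags_iff[of "fst F" "snd F"] by simp
  have odd: "N (- v) = - N v" "M (- v) = - M v" for v
    using N M signed_seminorm_minus by (auto simp: nonzero_signed_seminorms_def)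
  obtain c where c: "c \<noteq> 0" "\<And>i v. i < length (snd F) \<Longrightarrow> v \<in> snd F ! i \<Longrightarrow> N v = c * (ds @ [1]) ! i"
    "\<And>v. v \<in> fst F ! 0 \<Longrightarrow> N v = 0"
    using N(2) by (auto simp: encoded_by_def)
  obtain c' where c': "c' \<noteq> 0" "\<And>i v. i < length (snd F) \<Longrightarrow> v \<in> snd F ! i \<Longrightarrow> M v = c' * (ds @ [1]) ! i"
    "\<And>v. v \<in> fst F ! 0 \<Longrightarrow> M v = 0"
    using M(2) by (auto simp: encoded_by_def)
  have region: "M v = c' / c * N v" if "i < length (snd F)" "v \<in> snd F ! i" for i v
    using c(1) c(2)[OF that] c'(2)[OF that] by simp
  have "M v = c' / c * N v" for v
  proof (rule subspace_flag_cases[OF flag UNIV_I, of v])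
    assume "v \<in> fst F ! 0"
    then show ?thesis using c(3) c'(3) by simp
  next
    fix i assume "i < length (snd F)" "v \<in> snd F ! i \<or> - v \<in> snd F ! i"
    then show ?thesis using region[of i v] region[of i "- v"] by (auto simp: odd)
  qed
  then show ?thesis
    using N(1) M(1) c(1) c'(1) by (auto simp: homothety_def intro!: exI[of _ "c' / c"])
qed

section \<open>The signed seminorm of a weighted flag\<close>

text \<open>The function is extended from \<open>V\<^sub>k\<close> to \<open>V\<^sub>k\<^sub>+\<^sub>1\<close> by the value \<open>e\<^sub>k\<close> on the chosen side and \<open>- e\<^sub>k\<close> on the other.
  The last conjunct says that all later values dominate the function built so far. This makes
  \<open>e\<^sub>k\<close> its largest absolute value on \<open>V\<^sub>k\<^sub>+\<^sub>1\<close>, and the ultrametric inequality then reduces to a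
  comparison of sides.\<close>

lemma ex_signed_seminorm_up_to_level:
  fixes Vs :: "'w::real_vector set list"
  assumes flag: "subspace_flag U Vs Hs" and len: "length es = length Hs"
    and srt: "sorted es" and pos: "\<forall>e \<in> set es. e > 0" and "k \<le> length Hs"
  shows "\<exists>N :: 'w \<Rightarrow> real. (\<forall>a. \<forall>v \<in> Vs ! k. N (a *\<^sub>R v) = sgn a * N v) \<and>
    (\<forall>v \<in> Vs ! k. \<forall>w \<in> Vs ! k. N (v + w) \<le> max (N v) (N w)) \<and>
    (\<forall>v \<in> Vs ! 0. N v = 0) \<and> (\<forall>i < k. \<forall>v \<in> Hs ! i. N v = es ! i) \<and>
    (\<forall>v \<in> Vs ! k. \<forall>j < length Hs. k \<le> j \<longrightarrow> \<bar>N v\<bar> \<le> es ! j)"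
  using assms(5)
proof (induction k)
  case 0
  have "es ! j > 0" if "j < length Hs" for j using pos len that by simp
  then show ?case by (intro exI[of _ "\<lambda>_. 0"]) (auto simp: less_imp_le)
next
  case (Suc k)
  have k: "k < length Hs" using Suc.prems by simp
  obtain N :: "'w \<Rightarrow> real" where
    scale: "\<forall>a. \<forall>v \<in> Vs ! k. N (a *\<^sub>R v) = sgn a * N v" and
    add: "\<forall>v \<in> Vs ! k. \<forall>w \<in> Vs ! k. N (v + w) \<le> max (N v) (N w)" and
    zero: "\<forall>v \<in> Vs ! 0. N v = 0" and
    val: "\<forall>i < k. \<forall>v \<in> Hs ! i. N v = es ! i" and
    bnd: "\<forall>v \<in> Vs ! k. \<forall>j < length Hs. k \<le> j \<longrightarrow> \<bar>N v\<bar> \<le> es ! j"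
    using Suc.IH[OF Suc_leD[OF Suc.prems]] by blast
  obtain f :: "'w \<Rightarrow> real" and y where f: "linear f" and Vk: "Vs ! k = {v \<in> Vs ! Suc k. f v = 0}"
    and Hk: "Hs ! k = {v \<in> Vs ! Suc k. f v > 0}" and "y \<in> Hs ! k"
    by (rule subspace_flag_functional[OF flag k])
  have sub: "subspace (Vs ! k)" "subspace (Vs ! Suc k)"
    using subspace_flag_subspace[OF flag] Suc.prems by auto
  define e where "e = es ! k"
  have e: "e > 0" using pos len k by (simp add: e_def)
  define M where "M v = (if f v = 0 then N v else sgn (f v) * e)" for v
  have M_eq: "M v = N v" if "v \<in> Vs ! k" for v using that Vk by (simp add: M_def)
  have M_bnd: "\<bar>M v\<bar> \<le> e" if "v \<in> Vs ! Suc k" for v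
    
  proof (cases "f v = 0")
    case True
    then show ?thesis using bnd that k Vk by (auto simp: M_def e_def)
  next
    case False
    then show ?thesis using e by (simp add: M_def abs_mult abs_sgn_eq)
  qed
  have N0: "N 0 = 0" using scale[rule_format, of 0 0] sub(1) by (simp add: subspace_0)
  have "M (a *\<^sub>R v) = sgn a * M v" if "v \<in> Vs ! Suc k" for a v
  proof (cases "a = 0 \<or> f v \<noteq> 0")
    case True
    then show ?thesis using N0 by (auto simp: M_def linear_scale[OF f] linear_0[OF f] sgn_mult)
  next
    case False
    then show ?thesis using scale that Vk by (simp add: M_def linear_scale[OF f])
  qed
  moreover have "M (v + w) \<le> max (M v) (M w)" if v: "v \<in> Vs ! Suc k" and w: "w \<in> Vs ! Suc k" for v w
  proof -
    have vw: "v + w \<in> Vs ! Suc k" using v w sub by (simp add: subspace_add)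
    have fvw: "f (v + w) = f v + f w" by (rule linear_add[OF f])
    \<comment> \<open>either both vectors lie in the hyperplane, or one of them attains the maximum \<open>e\<close>, or the sum lies on the
    negative side and attains the minimum \<open>- e\<close>\<close>
    consider "f v = 0" "f w = 0" | "f v > 0 \<or> f w > 0" | "f v + f w < 0" by linarith
    then show ?thesis
    proof cases
      case 1
      then show ?thesis using add v w Vk by (simp add: M_def fvw)
    next
      case 2
      then have "M v = e \<or> M w = e" by (auto simp: M_def)
      then show ?thesis using M_bnd[OF vw] by linarith
    next
      case 3
      then have "M (v + w) = - e" by (simp add: M_def fvw)
      then show ?thesis using M_bnd[OF v] by linarith
    qed
  qed
  moreover have "M v = 0" if "v \<in> Vs ! 0" for v
    using that zero M_eq[of v] subspace_flag_mono[OF flag, of 0 k] k by auto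
  moreover have "M v = es ! i" if "i < Suc k" "v \<in> Hs ! i" for i v
  proof (cases "i = k")
    case True
    then show ?thesis using that Hk by (simp add: M_def e_def)
  next
    case False
    then have i: "i < k" using that by simp
    have "Hs ! i \<subseteq> Vs ! Suc i" 
      by (rule subspace_flag_functional[OF flag less_trans[OF i k]]) blast
    moreover have "Vs ! Suc i \<subseteq> Vs ! k" using subspace_flag_mono[OF flag, of "Suc i" k] i k by simp
    ultimately show ?thesis using M_eq[of v] val i that(2) by auto
  qed
  moreover have "\<bar>M v\<bar> \<le> es ! j" if "v \<in> Vs ! Suc k" "j < length Hs" "Suc k \<le> j" for v j
  proof -
    have "e \<le> es ! j" using sorted_nth_mono[OF srt, of k j] that len by (simp add: e_def)
    then show ?thesis using M_bnd[OF that(1)] by simp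
  qed
  ultimately show ?case by (intro exI[of _ M]) blast
qed

lemma ex_encoded_signed_seminorm:
  fixes F :: "'w::real_vector sflag"
  assumes "(F, ds) \<in> weighted_signed_flags"
  shows "\<exists>N \<in> nonzero_signed_seminorms. encoded_by N F ds"
proof -
  obtain Vs Hs where F_eq: "F = (Vs, Hs)" by fastforce
  have flag: "subspace_flag UNIV Vs Hs" and len: "length Hs = length ds + 1"
    and srt: "sorted (ds @ [1])" and pos: "\<forall>d \<in> set (ds @ [1]). d > 0"
    using assms
    by (auto simp: weighted_signed_flags_def flag_weights_def signed_flags_iff F_eq sorted_append)
  have len': "length (ds @ [1]) = length Hs" using len by simp
  obtain N :: "'w \<Rightarrow> real" where N: "\<forall>a. \<forall>v \<in> UNIV. N (a *\<^sub>R v) = sgn a * N v"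
      "\<forall>v \<in> UNIV. \<forall>w \<in> UNIV. N (v + w) \<le> max (N v) (N w)"
      "\<forall>v \<in> Vs ! 0. N v = 0" "\<forall>i < length Hs. \<forall>v \<in> Hs ! i. N v = (ds @ [1]) ! i"
    using ex_signed_seminorm_up_to_level[OF flag len' srt pos order_refl]
    unfolding subspace_flag_top[OF flag] by blast
  have scale: "N (a *\<^sub>R v) = sgn a * N v" for a v using N(1) by simp
  have add: "N (v + w) \<le> max (N v) (N w)" for v w using N(2) by simp
  \<comment> \<open>the lower bound is the upper bound for the opposite vectors, as \<open>N\<close> is odd\<close>
  have "min (N v) (N w) \<le> N (v + w)" for v w
    using add[of "- v" "- w"] scale[of "- 1" v] scale[of "- 1" w] scale[of "- 1" "v + w"]
    by (simp add: add.commute min_def max_def split: if_splits)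
  then have "signed_seminorm N"
    using scale add by (auto simp: signed_seminorm_def trivial_abs_def)
  moreover have "\<exists>y. N y \<noteq> 0"
  proof -
    obtain y where "y \<in> Hs ! length ds"
      using subspace_flag_region_nonempty[OF flag, of "length ds"] len by auto
    then have "N y = 1" using N(4) len nth_append_length[of ds 1 "[]"] by (metis less_add_one)
    then show ?thesis by (intro exI[of _ y]) simp
  qed
  ultimately have "N \<in> nonzero_signed_seminorms" by (simp add: nonzero_signed_seminorms_def)
  moreover have "encoded_by N F ds"
    using N(3,4) by (auto simp: encoded_by_def F_eq intro!: exI[of _ 1])
  ultimately show ?thesis by blast
qed

section \<open>The dual of a finite-dimensional space\<close>

text \<open>The coordinate functionals of a basis form the required spanning set.\<close>

lemma finite_spanning_set_dual:
  assumes "\<exists>B :: 'v::real_vector set. finite B \<and> span B = UNIV"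
  shows "\<exists>S :: 'v dual set. finite S \<and> span S = UNIV"
proof -
  obtain B :: "'v set" where B: "finite B" "independent B" "span B = UNIV"
    using assms finite_basis_of_subspace[OF _ _ subspace_UNIV] by metis
  define \<delta> where "\<delta> b = Dual (\<lambda>x. representation B x b)" for b
  have \<delta>: "dual_apply (\<delta> b) x = representation B x b" for b x
    unfolding \<delta>_def using B
    by (subst Dual_inverse) (auto simp: linear_iff representation_add representation_scale)
  have sum: "dual_apply (\<Sum>b \<in> A. a b *\<^sub>R \<delta> b) x = (\<Sum>b \<in> A. a b * representation B x b)"
    if "finite A" for A a x
    using that by (induction A) (auto simp: \<delta>)
  have "\<phi> \<in> span (\<delta> ` B)" for \<phi>
  proof -
    have "\<phi> = (\<Sum>b \<in> B. dual_apply \<phi> b *\<^sub>R \<delta> b)"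
    proof (rule dual_eqI)
      fix x
      have "dual_apply \<phi> x = dual_apply \<phi> (\<Sum>b \<in> B. representation B x b *\<^sub>R b)"
        using sum_representation_eq[of B x B] B by simp
      then have "dual_apply \<phi> x = (\<Sum>b \<in> B. representation B x b * dual_apply \<phi> b)"
        using linear_sum[OF linear_dual_apply[of \<phi>], of "\<lambda>b. representation B x b *\<^sub>R b" B]
        by (simp add: linear_scale[OF linear_dual_apply])
      then show "dual_apply \<phi> x = dual_apply (\<Sum>b \<in> B. dual_apply \<phi> b *\<^sub>R \<delta> b) x"
        by (simp add: sum B mult.commute)
    qed
    moreover have "(\<Sum>b \<in> B. dual_apply \<phi> b *\<^sub>R \<delta> b) \<in> span (\<delta> ` B)"
      by (intro span_sum span_scale span_base) auto
    ultimately show ?thesis by simp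
  qed
  then show ?thesis using B(1) by (intro exI[of _ "\<delta> ` B"]) auto
qed

section \<open>The bijection\<close>

text \<open>Equivalence on the right is expressed by a map \<open>q\<close> and not by a second relation, because
  a weighted flag class consists of a class of flags and an unchanged list of weights.\<close>

lemma bij_betw_of_correspondence:
  assumes r: "equiv A r"
    and total: "\<And>a. a \<in> A \<Longrightarrow> \<exists>b \<in> B. R a b"
    and surj: "\<And>b. b \<in> B \<Longrightarrow> \<exists>a \<in> A. R a b"
    and left: "\<And>a a' b. a \<in> A \<Longrightarrow> a' \<in> A \<Longrightarrow> b \<in> B \<Longrightarrow> R a b \<Longrightarrow> R a' b \<longleftrightarrow> (a, a') \<in> r"
    and right: "\<And>a b b'. a \<in> A \<Longrightarrow> b \<in> B \<Longrightarrow> b' \<in> B \<Longrightarrow> R a b \<Longrightarrow> R a b' \<longleftrightarrow> q b = q b'"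
  shows "\<exists>\<Phi>. bij_betw \<Phi> (A // r) (q ` B) \<and> (\<forall>a \<in> A. \<forall>b \<in> B. \<Phi> (r `` {a}) = q b \<longleftrightarrow> R a b)"
proof -
  define \<Phi> where "\<Phi> X = (THE y. \<exists>a \<in> X. \<exists>b \<in> B. R a b \<and> y = q b)" for X
  have \<Phi>: "\<Phi> (r `` {a}) = q b" if a: "a \<in> A" and b: "b \<in> B" and ab: "R a b" for a b
    unfolding \<Phi>_def
  proof (rule the_equality)
    show "\<exists>a' \<in> r `` {a}. \<exists>b' \<in> B. R a' b' \<and> q b = q b'"
      using equiv_class_self[OF r a] b ab by blast
    fix y assume "\<exists>a' \<in> r `` {a}. \<exists>b' \<in> B. R a' b' \<and> y = q b'"
    then obtain a' b' where "(a, a') \<in> r" "b' \<in> B" "R a' b'" "y = q b'" by blast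
    moreover have "a' \<in> A" using \<open>(a, a') \<in> r\<close> r by (auto simp: equiv_def)
    ultimately show "y = q b" using left[OF a _ b ab] right b by blast
  qed
  have iff: "\<Phi> (r `` {a}) = q b \<longleftrightarrow> R a b" if "a \<in> A" "b \<in> B" for a b
    using total[OF that(1)] \<Phi>[OF that(1)] right[OF that(1)] that(2) by metis
  have "bij_betw \<Phi> (A // r) (q ` B)"
  proof (rule bij_betw_imageI)
    show "inj_on \<Phi> (A // r)"
    proof (rule inj_onI, elim quotientE)
      fix X Y a a' assume eq: "\<Phi> X = \<Phi> Y" and a: "a \<in> A" "X = r `` {a}" and a': "a' \<in> A" "Y = r `` {a'}"
      obtain b where b: "b \<in> B" "R a b" using total a by blast
      then have "R a' b" using iff a a' eq by metis
      then show "X = Y" using left[OF a(1) a'(1) b] a a' equiv_class_eq[OF r] by simp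
    qed
    show "\<Phi> ` (A // r) = q ` B"
    proof
      show "\<Phi> ` (A // r) \<subseteq> q ` B" using total \<Phi> by (fastforce elim!: quotientE)
      show "q ` B \<subseteq> \<Phi> ` (A // r)"
      proof
        fix y assume "y \<in> q ` B"
        then obtain a b where "y = q b" "b \<in> B" "a \<in> A" "R a b" using surj by blast
        then show "y \<in> \<Phi> ` (A // r)" using \<Phi> quotientI[of a A r] by (metis imageI)
      qed
    qed
  qed
  then show ?thesis using iff by blast
qed

theorem proposition7p8:
  fixes n :: nat
  assumes "\<exists>B :: 'v::real_vector set. finite B \<and> span B = UNIV"
    and "dim (UNIV :: 'v set) = n"
  shows "\<exists>\<Phi>. bij_betw \<Phi> (RX :: ('v dual \<Rightarrow> real) set set) weighted_flag_classes \<and>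
    (\<forall>N \<in> nonzero_signed_seminorms. \<forall>(F, ds) \<in> weighted_signed_flags.
       \<Phi> (homothety `` {N}) = (flag_equiv `` {F}, ds) \<longleftrightarrow> encoded_by N F ds)"
proof -
  let ?A = "nonzero_signed_seminorms :: ('v dual \<Rightarrow> real) set"
  let ?R = "\<lambda>(N :: 'v dual \<Rightarrow> real) b. encoded_by N (fst b) (snd b)"
  define q where "q b = (flag_equiv `` {fst b :: 'v dual sflag}, snd b :: real list)" for b
  have classes: "weighted_flag_classes = q ` weighted_signed_flags"
    by (force simp: weighted_flag_classes_def q_def)
  obtain S :: "'v dual set" where fin: "finite S" "span S = UNIV"
    using finite_spanning_set_dual[OF assms(1)] by blast
  have odd: "N (- v) = - N v" if "N \<in> ?A" for N v
    using that signed_seminorm_minus by (auto simp: nonzero_signed_seminorms_def)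
  have "\<exists>\<Phi>. bij_betw \<Phi> (?A // homothety) (q ` weighted_signed_flags) \<and>
      (\<forall>N \<in> ?A. \<forall>b \<in> weighted_signed_flags. \<Phi> (homothety `` {N}) = q b \<longleftrightarrow> ?R N b)"
  proof (rule bij_betw_of_correspondence[OF equiv_homothety])
    fix N assume "N \<in> ?A"
    then show "\<exists>b \<in> weighted_signed_flags. ?R N b"
      using ex_encoding[OF _ fin, of N] by (simp add: split_beta)
  next
    fix b :: "'v dual sflag \<times> real list" assume "b \<in> weighted_signed_flags"
    then show "\<exists>N \<in> ?A. ?R N b" using ex_encoded_signed_seminorm[of "fst b" "snd b"] by simp
  next
    fix N M and b :: "'v dual sflag \<times> real list"
    assume "N \<in> ?A" "M \<in> ?A" and b: "b \<in> weighted_signed_flags" and "?R N b"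
    moreover have "fst b \<in> signed_flags" using b by (auto simp: weighted_signed_flags_def)
    ultimately show "?R M b \<longleftrightarrow> (N, M) \<in> homothety"
      using encoded_by_imp_homothety encoded_by_homothety by blast
  next
    fix N and b b' :: "'v dual sflag \<times> real list"
    assume N: "N \<in> ?A" and b: "b \<in> weighted_signed_flags" "b' \<in> weighted_signed_flags" and enc: "?R N b"
    have "fst b \<in> signed_flags" "fst b' \<in> signed_flags"
      using b by (auto simp: weighted_signed_flags_def)
    then have "q b = q b' \<longleftrightarrow> (fst b, fst b') \<in> flag_equiv \<and> snd b = snd b'"
      by (simp add: q_def eq_equiv_class_iff[OF equiv_flag_equiv])
    also have "\<dots> \<longleftrightarrow> ?R N b'"
      using encoding_unique[where N = N, OF odd[OF N], of "fst b" "snd b" "fst b'" "snd b'"]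
        encoded_by_flag_equiv[where N = N, OF odd[OF N], of "fst b" "fst b'" "snd b"] b enc by auto
    finally show "?R N b' \<longleftrightarrow> q b = q b'" by simp
  qed
  then show ?thesis unfolding RX_def classes by (simp add: q_def split_beta)
qed

end
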